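(* Let $\alpha\ge 2$ and $\beta\ge 0$. If $E_{\alpha,\beta}$ has no non-real zeros, then $|E_{\alpha,\beta}(z)|\ge E_{\alpha,\beta}(\Re z)$ for all $z\in\mathbb{C}$.
   Context: For $\alpha>0$ and $\beta\in\mathbb{R}$, the two-parameter Mittag-Leffler function is the entire function $E_{\alpha,\beta}(z)=\sum_{k=0}^{\infty}\frac{z^k}{\Gamma(\alpha k+\beta)}$, $z\in\mathbb{C}$, with the convention $1/\Gamma(s)=0$ at the poles $s=0,-1,-2,\dots$ of $\Gamma$. $\Re z$ denotes the real part of $z$; $E_{\alpha,\beta}$ is real-valued on $\mathbb{R}$. *)

theory Defs
  imports "HOL-Analysis.Analysis"
begin

text \<open>
  \<^term>\<open>rGamma\<close> is the reciprocal Gamma function, which vanishes at the poles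
  \<open>0, -1, -2, \<dots>\<close> of \<^term>\<open>Gamma\<close>.
\<close>

definition mittag_leffler :: "real \<Rightarrow> real \<Rightarrow> complex \<Rightarrow> complex" where
  "mittag_leffler \<alpha> \<beta> z = (\<Sum>k. complex_of_real (rGamma (\<alpha> * real k + \<beta>)) * z ^ k)"

end

theory Submission
  imports Defs "HOL-Complex_Analysis.Complex_Analysis"
begin

(* After a translation the claim is |f(iy)| >= |f(0)| for f entire of minimal exponential type with
   real nonzero zeros a. Dividing f by the finite product P of the factors 1 - z/a over the zeros
   with |a| <= R gives a function g that has no zeros in that disc and is bounded by the maximum
   of |f| on |z| = 2R, because every factor has modulus at least 1 there. Harnack's inequality for
   log |g| and the growth of f show that |g(z)| >= |f(0)| exp(-o(1)) as R tends to infinity, whereas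
   |P(iy)| >= 1. No convergence of the infinite product is needed. *)

section \<open>Factoring zeros out of an entire function\<close>

text \<open>The factor \<open>1 - z / a\<close> in place of \<open>z - a\<close> preserves the value
  at 0. The point \<open>b\<close> rules out the zero function, so the order at \<open>a\<close> is
  finite; it may be 0.\<close>

lemma entire_divide_zero:
  assumes f: "f holomorphic_on UNIV" and nz: "f b \<noteq> 0" and a: "a \<noteq> 0"
  obtains h n where "h holomorphic_on UNIV" "h a \<noteq> 0" "\<And>z. f z = h z * (1 - z / a) ^ n"
proof -
  define n where "n = nat (zorder f a)"
  obtain r where r: "r > 0" "zor_poly f a holomorphic_on cball a r"
    and fac: "\<And>w. w \<in> cball a r \<Longrightarrow> f w = zor_poly f a w * (w - a) ^ n \<and> zor_poly f a w \<noteq> 0"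
    using zorder_exist_zero[OF f, of a] nz connected_UNIV unfolding n_def by blast
  \<comment> \<open>The quotient with its singularity at \<open>a\<close> filled in: near
    \<open>a\<close> it equals \<open>zor_poly f a\<close>, and off \<open>a\<close> it is a
    quotient of holomorphic functions.\<close>
  define k where "k w = (if w = a then zor_poly f a a else f w / (w - a) ^ n)" for w
  have "k holomorphic_on ball a r"
  proof (rule holomorphic_transform[of "zor_poly f a"])
    show "zor_poly f a holomorphic_on ball a r"
      using r(2) by (rule holomorphic_on_subset) auto
    show "zor_poly f a w = k w" if "w \<in> ball a r" for w
      using fac[of w] that by (auto simp: k_def)
  qed
  moreover have "k holomorphic_on (- {a})"
  proof (rule holomorphic_transform[of "\<lambda>w. f w / (w - a) ^ n"])
    show "(\<lambda>w. f w / (w - a) ^ n) holomorphic_on (- {a})"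
      by (intro holomorphic_intros holomorphic_on_subset[OF f]) auto
  qed (auto simp: k_def)
  ultimately have "k holomorphic_on (ball a r \<union> - {a})"
    by (intro holomorphic_on_Un) auto
  moreover have "ball a r \<union> - {a} = UNIV"
    using r(1) by auto
  ultimately have k: "k holomorphic_on UNIV"
    by simp
  have fk: "f z = k z * (z - a) ^ n" for z
    using fac[of a] r(1) by (auto simp: k_def)
  show ?thesis
  proof (rule that[of "\<lambda>z. k z * (- a) ^ n" n])
    show "(\<lambda>z. k z * (- a) ^ n) holomorphic_on UNIV"
      by (intro holomorphic_intros k)
    show "k a * (- a) ^ n \<noteq> 0"
      using fac[of a] r(1) a by (auto simp: k_def)
    show "f z = k z * (- a) ^ n * (1 - z / a) ^ n" for z
    proof -
      have "z - a = - a * (1 - z / a)"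
        using a by (simp add: field_simps)
      then show ?thesis
        by (simp only: fk power_mult_distrib mult.assoc)
    qed
  qed
qed

lemma entire_divide_finite_zeros:
  assumes "finite Z" "f holomorphic_on UNIV" "f b \<noteq> 0" "0 \<notin> Z"
  shows "\<exists>g n. g holomorphic_on UNIV \<and> (\<forall>a\<in>Z. g a \<noteq> 0) \<and>
           (\<forall>z. f z = g z * (\<Prod>a\<in>Z. (1 - z / a) ^ n a))"
  using assms
proof (induction Z arbitrary: f rule: finite_induct)
  case empty
  then show ?case by auto
next
  case (insert a Z)
  obtain h m where h: "h holomorphic_on UNIV" "h a \<noteq> 0" "\<And>z. f z = h z * (1 - z / a) ^ m"
    using entire_divide_zero[of f b a] insert.prems by auto
  have "h b \<noteq> 0"
    using h(3)[of b] insert.prems by auto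
  then obtain g n where g: "g holomorphic_on UNIV" "\<forall>a\<in>Z. g a \<noteq> 0"
      "\<And>z. h z = g z * (\<Prod>a\<in>Z. (1 - z / a) ^ n a)"
    using insert.IH[of h] h insert.prems by blast
  \<comment> \<open>Since \<open>h a\<close> is \<open>g a\<close> times a product, the later
    divisions cannot create a zero at \<open>a\<close>.\<close>
  have "g a \<noteq> 0"
    using h(2) g(3)[of a] by auto
  moreover have "f z = g z * (\<Prod>c\<in>insert a Z. (1 - z / c) ^ (n(a := m)) c)" for z
  proof -
    have "(\<Prod>c\<in>Z. (1 - z / c) ^ (n(a := m)) c) = (\<Prod>c\<in>Z. (1 - z / c) ^ n c)"
      using insert.hyps by (intro prod.cong) auto
    then show ?thesis
      using insert.hyps by (simp add: h(3) g(3) mult_ac)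
  qed
  ultimately show ?case
    using g by blast
qed

section \<open>Harnack's inequality and zero-free functions\<close>

text \<open>The Schwarz lemma is applied to the Cayley transform \<open>(p - L) / (p + L)\<close>.\<close>

lemma Harnack_upper_bound:
  assumes p: "p holomorphic_on ball 0 R" and pos: "\<And>w. w \<in> ball 0 R \<Longrightarrow> Re (p w) > 0"
    and p0: "p 0 = complex_of_real L" and z: "cmod z < R"
  shows "cmod (p z) \<le> L * (R + cmod z) / (R - cmod z)"
proof -
  have R: "R > 0"
    using z by (meson le_less_trans norm_ge_zero)
  have L: "L > 0"
    using pos[of 0] p0 R by simp
  define \<psi> where "\<psi> w = (p (R * w) - L) / (p (R * w) + L)" for w :: complex
  have inball: "complex_of_real R * w \<in> ball 0 R" if "cmod w < 1" for w
    using that R by (simp add: norm_mult)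
  have ne: "p w + L \<noteq> 0" if "w \<in> ball 0 R" for w
    using pos[OF that] L by (auto simp: complex_eq_iff)
  have "(\<lambda>w::complex. p (R * w)) holomorphic_on ball 0 1"
    by (rule holomorphic_on_compose_gen[OF _ p, of "\<lambda>w. R * w" "ball 0 1", unfolded o_def])
      (use inball in \<open>auto intro!: holomorphic_intros\<close>)
  then have "\<psi> holomorphic_on ball 0 1"
    unfolding \<psi>_def using ne inball by (intro holomorphic_intros) auto
  moreover have "\<psi> 0 = 0"
    by (simp add: \<psi>_def p0)
  moreover have "cmod (\<psi> w) < 1" if "cmod w < 1" for w
  proof -
    let ?u = "p (R * w)"
    \<comment> \<open>By this identity a point of the right half-plane is closer to \<open>L\<close>
      than to \<open>-L\<close>, so \<psi> maps into the unit disc.\<close>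
    have "(cmod (?u + L))\<^sup>2 - (cmod (?u - L))\<^sup>2 = 4 * L * Re ?u"
      unfolding cmod_power2 by (simp add: power2_eq_square algebra_simps)
    moreover have "4 * L * Re ?u > 0"
      using L pos[OF inball[OF that]] by simp
    ultimately have "(cmod (?u - L))\<^sup>2 < (cmod (?u + L))\<^sup>2"
      by linarith
    then have "cmod (?u - L) < cmod (?u + L)"
      by (simp add: power2_less_imp_less)
    then show ?thesis
      unfolding \<psi>_def norm_divide using ne[OF inball[OF that]] by simp
  qed
  ultimately have "cmod (\<psi> (z / R)) \<le> cmod (z / R)"
    using z R by (intro Schwarz_Lemma(1)) (auto simp: norm_divide)
  moreover have "p z + L \<noteq> 0"
    using ne[of z] z by simp
  ultimately have "cmod (p z - L) * R \<le> cmod z * cmod (p z + L)"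
    using R by (simp add: \<psi>_def norm_divide field_simps)
  \<comment> \<open>The triangle inequality on both sides leaves an inequality linear in
    \<open>cmod (p z)\<close>.\<close>
  moreover have "(cmod (p z) - L) * R \<le> cmod (p z - L) * R"
    using R L norm_triangle_ineq2[of "p z" "complex_of_real L"] by (intro mult_right_mono) auto
  moreover have "cmod z * cmod (p z + L) \<le> cmod z * (cmod (p z) + L)"
    using L norm_triangle_ineq[of "p z" "complex_of_real L"] by (intro mult_left_mono) auto
  ultimately have "(cmod (p z) - L) * R \<le> cmod z * (cmod (p z) + L)"
    by linarith
  then show ?thesis
    using z by (simp add: field_simps)
qed

text \<open>With \<open>h\<close> a logarithm of \<open>g\<close>, \<open>A - Re h\<close> is a
  positive harmonic function, and Harnack's upper bound for it is a lower bound for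
  \<open>ln (cmod (g z))\<close>.\<close>

lemma zero_free_lower_bound:
  assumes g: "g holomorphic_on ball 0 R" and nz: "\<And>w. w \<in> ball 0 R \<Longrightarrow> g w \<noteq> 0"
    and bd: "\<And>w. w \<in> ball 0 R \<Longrightarrow> cmod (g w) < exp A" and z: "cmod z < R"
  shows "ln (cmod (g z)) \<ge> ln (cmod (g 0)) - (A - ln (cmod (g 0))) * (2 * cmod z / (R - cmod z))"
proof -
  have R: "R > 0"
    using z by (meson le_less_trans norm_ge_zero)
  obtain h where h: "h holomorphic_on ball 0 R" "\<And>w. w \<in> ball 0 R \<Longrightarrow> g w = exp (h w)"
    using contractible_imp_holomorphic_log[OF g convex_imp_contractible] nz by auto
  have Re_h: "Re (h w) = ln (cmod (g w))" if "w \<in> ball 0 R" for w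
    using h(2)[OF that] by simp
  \<comment> \<open>The imaginary constant makes \<open>p 0\<close> real without changing any real
    part.\<close>
  define p where "p w = A - h w + \<i> * Im (h 0)" for w
  have "p holomorphic_on ball 0 R"
    unfolding p_def by (intro holomorphic_intros h)
  moreover have "Re (p w) > 0" if "w \<in> ball 0 R" for w
    using bd[OF that] h(2)[OF that] by (simp add: p_def)
  moreover have "p 0 = complex_of_real (A - ln (cmod (g 0)))"
    using Re_h[of 0] R by (simp add: p_def complex_eq_iff)
  ultimately have "cmod (p z) \<le> (A - ln (cmod (g 0))) * (R + cmod z) / (R - cmod z)"
    using z by (intro Harnack_upper_bound) auto
  moreover have "A - ln (cmod (g z)) \<le> cmod (p z)"
    using complex_Re_le_cmod[of "p z"] Re_h[of z] z by (simp add: p_def)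
  \<comment> \<open>Once the 1 is split off, \<open>A\<close> cancels and survives only with a
    weight that decays like 1/R for fixed \<open>z\<close>.\<close>
  moreover have "(R + cmod z) / (R - cmod z) = 1 + 2 * cmod z / (R - cmod z)"
    using z by (simp add: field_simps)
  then have "(A - ln (cmod (g 0))) * (R + cmod z) / (R - cmod z) =
      (A - ln (cmod (g 0))) * (1 + 2 * cmod z / (R - cmod z))"
    by (metis times_divide_eq_right)
  ultimately show ?thesis
    by (simp add: algebra_simps)
qed

section \<open>Entire functions of minimal exponential type\<close>

definition minimal_exponential_type :: "(complex \<Rightarrow> complex) \<Rightarrow> bool" where
  "minimal_exponential_type f \<longleftrightarrow>
     (\<forall>\<epsilon>>0. \<exists>C>0. \<forall>z. cmod (f z) \<le> C * exp (\<epsilon> * cmod z))"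

lemma minimal_exponential_type_shift:
  assumes "minimal_exponential_type f"
  shows "minimal_exponential_type (\<lambda>z. f (c + z))"
  unfolding minimal_exponential_type_def
proof (intro allI impI)
  fix \<epsilon> :: real assume \<epsilon>: "\<epsilon> > 0"
  then obtain C where C: "C > 0" "\<And>z. cmod (f z) \<le> C * exp (\<epsilon> * cmod z)"
    using assms unfolding minimal_exponential_type_def by blast
  have "cmod (f (c + z)) \<le> C * exp (\<epsilon> * cmod c) * exp (\<epsilon> * cmod z)" for z
  proof -
    have "\<epsilon> * cmod (c + z) \<le> \<epsilon> * (cmod c + cmod z)"
      using \<epsilon> norm_triangle_ineq[of c z] by (intro mult_left_mono) auto
    then have "C * exp (\<epsilon> * cmod (c + z)) \<le> C * exp (\<epsilon> * cmod c + \<epsilon> * cmod z)"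
      using C(1) by (simp add: distrib_left)
    then show ?thesis
      using C(2)[of "c + z"] by (simp add: exp_add mult.assoc)
  qed
  then show "\<exists>C>0. \<forall>z. cmod (f (c + z)) \<le> C * exp (\<epsilon> * cmod z)"
    using C(1) by (intro exI[of _ "C * exp (\<epsilon> * cmod c)"]) auto
qed

text \<open>The condition on zeros concerns the given \<open>z\<close> alone: it ensures that
  multiplying the zero-free quotient by the removed factors does not lower the modulus at
  \<open>z\<close>.\<close>

lemma minimal_type_norm_ge_at_0:
  assumes f: "f holomorphic_on UNIV" and f0: "f 0 \<noteq> 0"
    and type: "minimal_exponential_type f"
    and zeros: "\<And>a. f a = 0 \<Longrightarrow> cmod (1 - z / a) \<ge> 1"
  shows "cmod (f z) \<ge> cmod (f 0)"
proof (cases "f constant_on UNIV")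
  case True
  then show ?thesis
    by (metis constant_on_def UNIV_I order_refl)
next
  case False
  define r where "r = cmod z"
  \<comment> \<open>\<open>2 * R\<close> is the radius of the circle on which the quotient is
    estimated; the added 1 makes the estimate strict.\<close>
  have bound: "f z \<noteq> 0 \<and> ln (cmod (f z)) \<ge>
      ln (cmod (f 0)) - (ln C + \<epsilon> * (2 * R) + 1 - ln (cmod (f 0))) * (2 * r / (R - r))"
    if C: "C > 0" "\<And>w. cmod (f w) \<le> C * exp (\<epsilon> * cmod w)" and R: "R > r" for C \<epsilon> R
  proof -
    have R0: "R > 0"
      using R by (simp add: r_def) (meson le_less_trans norm_ge_zero)
    define Z where "Z = {a \<in> cball 0 R. f a = 0}"
    have "finite Z"
      unfolding Z_def by (rule holomorphic_compact_finite_zeros[OF f]) (use False in auto)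
    moreover have Z0: "0 \<notin> Z"
      using f0 by (simp add: Z_def)
    ultimately obtain g n where g: "g holomorphic_on UNIV" "\<And>a. a \<in> Z \<Longrightarrow> g a \<noteq> 0"
      and fg: "\<And>w. f w = g w * (\<Prod>a\<in>Z. (1 - w / a) ^ n a)"
      using entire_divide_finite_zeros[of Z f 0] f f0 by blast
    have g0: "g 0 = f 0"
      using fg[of 0] by simp
    \<comment> \<open>A zero of \<open>g\<close> in the disc is a zero of \<open>f\<close>, hence
      lies in \<open>Z\<close>, where \<open>g\<close> does not vanish.\<close>
    have g_nz: "g w \<noteq> 0" if "w \<in> ball 0 R" for w
      using g(2)[of w] fg[of w] that by (cases "f w = 0") (auto simp: Z_def)
    have prod_ge_1: "cmod (\<Prod>a\<in>Z. (1 - w / a) ^ n a) \<ge> 1"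
      if "\<And>a. a \<in> Z \<Longrightarrow> cmod (1 - w / a) \<ge> 1" for w
      unfolding prod_norm[symmetric] norm_power using that by (intro prod_ge_1 one_le_power)
    have g_le: "cmod (g w) \<le> cmod (f w)" if "\<And>a. a \<in> Z \<Longrightarrow> cmod (1 - w / a) \<ge> 1" for w
      using mult_left_mono[OF prod_ge_1[OF that], of "cmod (g w)"] by (simp add: fg[of w] norm_mult)
    \<comment> \<open>Here \<open>w / a\<close> has modulus at least 2, so each factor has modulus
      at least 2 - 1.\<close>
    have sphere: "cmod (g w) \<le> C * exp (\<epsilon> * (2 * R))" if "cmod w = 2 * R" for w
    proof -
      have "cmod (1 - w / a) \<ge> 1" if "a \<in> Z" for a
      proof -
        have "0 < cmod a" "cmod a \<le> R"
          using that Z0 by (auto simp: Z_def)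
        then have "cmod (w / a) \<ge> 2"
          using \<open>cmod w = 2 * R\<close> by (simp add: norm_divide field_simps)
        then show ?thesis
          using norm_triangle_ineq2[of "w / a" 1] by (simp add: norm_minus_commute)
      qed
      then show ?thesis
        using g_le[of w] C(2)[of w] that by fastforce
    qed
    have g_bound: "cmod (g w) < exp (ln C + \<epsilon> * (2 * R) + 1)" if "w \<in> ball 0 R" for w
    proof -
      have "cmod (g w) \<le> C * exp (\<epsilon> * (2 * R))"
      proof (rule maximum_modulus_frontier[of g "cball 0 (2 * R)"])
        show "g holomorphic_on interior (cball 0 (2 * R))"
          using g(1) by (rule holomorphic_on_subset) auto
        show "continuous_on (closure (cball 0 (2 * R))) g"
          using g(1) holomorphic_on_imp_continuous_on continuous_on_subset by blast
      qed (use that R0 sphere in auto)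
      also have "\<dots> = exp (ln C + \<epsilon> * (2 * R))"
        using C(1) by (simp add: exp_add)
      also have "\<dots> < exp (ln C + \<epsilon> * (2 * R) + 1)"
        by simp
      finally show ?thesis .
    qed
    have "ln (cmod (g 0)) - (ln C + \<epsilon> * (2 * R) + 1 - ln (cmod (g 0))) * (2 * cmod z / (R - cmod z))
        \<le> ln (cmod (g z))"
      using g_nz g_bound R by (intro zero_free_lower_bound holomorphic_on_subset[OF g(1)])
        (auto simp: r_def)
    moreover have "0 < cmod (g z)"
      using g_nz[of z] R by (simp add: r_def)
    moreover have "cmod (g z) \<le> cmod (f z)"
      using zeros by (intro g_le) (auto simp: Z_def)
    moreover from calculation have "ln (cmod (g z)) \<le> ln (cmod (f z))"
      by (intro ln_mono)
    ultimately show ?thesis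
      by (auto simp: g0 r_def)
  qed
  \<comment> \<open>For fixed \<epsilon> let \<open>R\<close> tend to infinity:
    \<open>\<epsilon> * (2 * R)\<close> times \<open>2 * r / (R - r)\<close> tends to
    \<open>\<epsilon> * (4 * r)\<close>, and the remaining terms times this weight vanish.\<close>
  have eps: "ln (cmod (f 0)) - \<epsilon> * (4 * r) \<le> ln (cmod (f z)) \<and> f z \<noteq> 0" if \<epsilon>: "\<epsilon> > 0" for \<epsilon>
  proof -
    obtain C where C: "C > 0" "\<And>w. cmod (f w) \<le> C * exp (\<epsilon> * cmod w)"
      using type \<epsilon> unfolding minimal_exponential_type_def by blast
    let ?b = "\<lambda>R. ln (cmod (f 0)) -
      (ln C + \<epsilon> * (2 * R) + 1 - ln (cmod (f 0))) * (2 * r / (R - r))"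
    have "(?b \<longlongrightarrow> ln (cmod (f 0)) - \<epsilon> * (4 * r)) at_top"
    proof -
      have "((\<lambda>R. l - (K + \<epsilon> * (2 * R) + 1 - l) * (2 * s / (R - s))) \<longlongrightarrow> l - \<epsilon> * (4 * s)) at_top"
        for l K s :: real
        by real_asymp
      then show ?thesis .
    qed
    moreover have "\<forall>\<^sub>F R in at_top. ?b R \<le> ln (cmod (f z))"
      using eventually_gt_at_top[of r] by eventually_elim (use bound[OF C] in blast)
    ultimately have "ln (cmod (f 0)) - \<epsilon> * (4 * r) \<le> ln (cmod (f z))"
      by (rule tendsto_upperbound) simp
    then show ?thesis
      using bound[OF C, of "r + 1"] by simp
  qed
  have "ln (cmod (f 0)) \<le> ln (cmod (f z))"
  proof (rule field_le_epsilon)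
    fix e :: real assume e: "e > 0"
    have r: "r \<ge> 0"
      by (simp add: r_def)
    \<comment> \<open>The 1 in the denominator covers the case \<open>r = 0\<close>.\<close>
    have "e / (4 * r + 1) * (4 * r) \<le> e"
      using e r by (simp add: field_simps)
    moreover have "e / (4 * r + 1) > 0"
      using e r by simp
    ultimately show "ln (cmod (f 0)) \<le> ln (cmod (f z)) + e"
      using eps by smt
  qed
  \<comment> \<open>Instantiating \<open>eps\<close> at 1 supplies \<open>f z \<noteq> 0\<close>,
    without which comparing logarithms would say nothing about moduli.\<close>
  then show ?thesis
    using eps[of 1] f0 by simp
qed

text \<open>Translation by the real number \<open>Re z\<close> keeps the zeros real and makes the
  point purely imaginary. If \<open>f\<close> vanishes at \<open>Re z\<close> the bound is trivial;
  otherwise the translate is nonzero at 0.\<close>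

theorem minimal_type_real_zeros_norm_ge_Re:
  assumes f: "f holomorphic_on UNIV" and type: "minimal_exponential_type f"
    and zeros: "\<And>a. f a = 0 \<Longrightarrow> a \<in> \<real>"
  shows "cmod (f z) \<ge> cmod (f (complex_of_real (Re z)))"
proof (cases "f (complex_of_real (Re z)) = 0")
  case False
  define x where "x = complex_of_real (Re z)"
  define F where "F w = f (x + w)" for w
  have zx: "z = x + \<i> * Im z"
    by (simp add: x_def complex_eq)
  have "cmod (F (\<i> * Im z)) \<ge> cmod (F 0)"
  proof (rule minimal_type_norm_ge_at_0)
    show "F holomorphic_on UNIV"
      unfolding F_def
      by (rule holomorphic_on_compose_gen[OF _ f, of "\<lambda>w. x + w" UNIV, unfolded o_def])
        (auto intro!: holomorphic_intros)
    show "F 0 \<noteq> 0"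
      using False by (simp add: F_def x_def)
    show "minimal_exponential_type F"
      unfolding F_def using type by (rule minimal_exponential_type_shift)
    show "cmod (1 - \<i> * Im z / a) \<ge> 1" if "F a = 0" for a
    proof -
      have "x + a \<in> \<real>"
        using zeros that by (simp add: F_def)
      then have "a \<in> \<real>"
        by (simp add: complex_is_Real_iff x_def)
      then obtain t where t: "a = complex_of_real t"
        by (elim Reals_cases)
      \<comment> \<open>An imaginary number divided by a real one has no real part.\<close>
      have "Re (1 - \<i> * Im z / a) = 1"
        by (simp add: t Re_divide_of_real)
      then show ?thesis
        using complex_Re_le_cmod[of "1 - \<i> * Im z / a"] by linarith
    qed
  qed
  then show ?thesis
    using zx by (simp add: F_def x_def)
qed simp

section \<open>Growth of the Mittag-Leffler function\<close>

text \<open>Gamma increases from 2 on, so \<open>Gamma s\<close> is at least (2k-1)!. Passing to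
  (2k)! costs a factor 2k, which \<open>4 ^ k\<close> absorbs.\<close>

lemma rGamma_le_inverse_fact:
  fixes s :: real
  assumes k: "k \<ge> 1" and s: "s \<ge> 2 * real k"
  shows "0 \<le> rGamma s" "rGamma s \<le> 4 ^ k / fact (2 * k)"
proof -
  have "Gamma (2 * real k) \<le> Gamma s"
    using Gamma_real_strict_mono[of "2 * real k" s] k s by (cases "s = 2 * real k") auto
  moreover have "Gamma (2 * real k) = fact (2 * k - 1)"
    using Gamma_fact[of "2 * k - 1", where ?'a = real] k by (simp add: of_nat_diff)
  ultimately have G: "fact (2 * k - 1) \<le> Gamma s"
    by simp
  have pos: "(0::real) < fact (2 * k - 1)"
    by simp
  show "0 \<le> rGamma s"
    using less_le_trans[OF pos G] by (simp add: rGamma_inverse_Gamma)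
  have "rGamma s \<le> inverse (fact (2 * k - 1))"
    unfolding rGamma_inverse_Gamma using G pos by (rule le_imp_inverse_le)
  also have "\<dots> = 2 * real k / fact (2 * k)"
    using fact_reduce[of "2 * k", where ?'a = real] k by (simp add: inverse_eq_divide)
  also have "\<dots> \<le> 4 ^ k / fact (2 * k)"
  proof (rule divide_right_mono)
    have "real (2 * k) < 2 ^ (2 * k)"
      by (rule of_nat_less_two_power)
    then show "2 * real k \<le> 4 ^ k"
      by (simp add: power_mult)
  qed simp
  finally show "rGamma s \<le> 4 ^ k / fact (2 * k)" .
qed

text \<open>At \<open>x = 2 * sqrt (cmod z)\<close> this sums the majorant with terms 4^k |z|^k /
  (2k)!.\<close>

lemma cosh_even_sums: "(\<lambda>k. x ^ (2 * k) / fact (2 * k)) sums cosh (x :: real)"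
proof -
  have "strict_mono (\<lambda>k::nat. 2 * k)"
    by (simp add: strict_mono_def)
  then have "(\<lambda>k. if even (2 * k) then x ^ (2 * k) /\<^sub>R fact (2 * k) else 0) sums cosh x"
    by (subst sums_mono_reindex) (use cosh_converges[of x] in \<open>auto elim!: evenE\<close>)
  then show ?thesis
    by (simp add: field_simps)
qed

text \<open>The factorial bound needs \<open>k \<ge> 1\<close>; the summand
  \<open>\<bar>rGamma \<beta>\<bar>\<close> of the prefactor takes care of the constant
  term.\<close>

lemma mittag_leffler_term_bound:
  assumes "\<alpha> \<ge> 2" "\<beta> \<ge> 0"
  shows "norm (complex_of_real (rGamma (\<alpha> * real k + \<beta>)) * z ^ k)
    \<le> (1 + \<bar>rGamma \<beta>\<bar>) * ((2 * sqrt (cmod z)) ^ (2 * k) / fact (2 * k))"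
proof -
  have "\<bar>rGamma (\<alpha> * real k + \<beta>)\<bar> \<le> (1 + \<bar>rGamma \<beta>\<bar>) * (4 ^ k / fact (2 * k))"
  proof (cases "k = 0")
    case False
    have "2 * real k \<le> \<alpha> * real k"
      using assms by (intro mult_right_mono) auto
    then have "2 * real k \<le> \<alpha> * real k + \<beta>"
      using assms by simp
    then have "\<bar>rGamma (\<alpha> * real k + \<beta>)\<bar> \<le> 1 * (4 ^ k / fact (2 * k))"
      using rGamma_le_inverse_fact[of k "\<alpha> * real k + \<beta>"] False by simp
    also have "\<dots> \<le> (1 + \<bar>rGamma \<beta>\<bar>) * (4 ^ k / fact (2 * k))"
      by (intro mult_right_mono) auto
    finally show ?thesis .
  qed simp
  then have "\<bar>rGamma (\<alpha> * real k + \<beta>)\<bar> * cmod z ^ k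
      \<le> (1 + \<bar>rGamma \<beta>\<bar>) * (4 ^ k / fact (2 * k)) * cmod z ^ k"
    by (rule mult_right_mono) simp
  also have "\<dots> = (1 + \<bar>rGamma \<beta>\<bar>) * ((2 * sqrt (cmod z)) ^ (2 * k) / fact (2 * k))"
    by (simp add: power_mult power_mult_distrib)
  finally show ?thesis
    by (simp add: norm_mult norm_power)
qed

lemma mittag_leffler_sums:
  assumes "\<alpha> \<ge> 2" "\<beta> \<ge> 0"
  shows "(\<lambda>k. complex_of_real (rGamma (\<alpha> * real k + \<beta>)) * z ^ k) sums mittag_leffler \<alpha> \<beta> z"
  unfolding mittag_leffler_def
  by (intro summable_sums summable_comparison_test'[OF _ mittag_leffler_term_bound[OF assms]]
      summable_mult sums_summable[OF cosh_even_sums])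

lemma mittag_leffler_entire:
  assumes "\<alpha> \<ge> 2" "\<beta> \<ge> 0"
  shows "mittag_leffler \<alpha> \<beta> holomorphic_on UNIV"
proof -
  have "mittag_leffler \<alpha> \<beta> holomorphic_on ball 0 r" for r
    using mittag_leffler_sums[OF assms] by (intro power_series_holomorphic) simp
  then have "mittag_leffler \<alpha> \<beta> field_differentiable at z" for z
    by (rule holomorphic_on_imp_differentiable_at[of _ "ball 0 (cmod z + 1)"]) auto
  then show ?thesis
    by (simp add: holomorphic_on_def)
qed

text \<open>Termwise comparison with the cosh series shows growth of order at most 1/2.\<close>

lemma norm_mittag_leffler_le:
  assumes "\<alpha> \<ge> 2" "\<beta> \<ge> 0"
  shows "cmod (mittag_leffler \<alpha> \<beta> z) \<le> (1 + \<bar>rGamma \<beta>\<bar>) * exp (2 * sqrt (cmod z))"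
proof -
  let ?x = "2 * sqrt (cmod z)"
  have "cmod (mittag_leffler \<alpha> \<beta> z) \<le> (1 + \<bar>rGamma \<beta>\<bar>) * cosh ?x"
    by (rule norm_sums_le[OF mittag_leffler_sums[OF assms] sums_mult[OF cosh_even_sums]
          mittag_leffler_term_bound[OF assms]])
  also have "cosh ?x \<le> exp ?x"
    by (simp add: cosh_def)
  finally show ?thesis
    by (simp add: mult_left_mono)
qed

lemma mittag_leffler_minimal_exponential_type:
  assumes "\<alpha> \<ge> 2" "\<beta> \<ge> 0"
  shows "minimal_exponential_type (mittag_leffler \<alpha> \<beta>)"
  unfolding minimal_exponential_type_def
proof (intro allI impI)
  fix \<epsilon> :: real assume \<epsilon>: "\<epsilon> > 0"
  let ?D = "1 + \<bar>rGamma \<beta>\<bar>"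
  have "cmod (mittag_leffler \<alpha> \<beta> z) \<le> ?D * exp (1 / \<epsilon>) * exp (\<epsilon> * cmod z)" for z
  proof -
    \<comment> \<open>Completing the square gives 2 sqrt|z| \<le> \<epsilon>|z| + 1/\<epsilon>,
      whence the constant \<open>exp (1 / \<epsilon>)\<close>.\<close>
    have "0 \<le> (\<epsilon> * sqrt (cmod z) - 1)\<^sup>2 / \<epsilon>"
      using \<epsilon> by simp
    also have "\<dots> = \<epsilon> * cmod z + 1 / \<epsilon> - 2 * sqrt (cmod z)"
      using \<epsilon> by (simp add: power2_diff power_mult_distrib field_simps power2_eq_square)
    finally have "?D * exp (2 * sqrt (cmod z)) \<le> ?D * exp (1 / \<epsilon> + \<epsilon> * cmod z)"
      by (intro mult_left_mono) auto
    then show ?thesis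
      using norm_mittag_leffler_le[OF assms, of z] by (simp add: exp_add mult.assoc)
  qed
  then show "\<exists>C>0. \<forall>z. cmod (mittag_leffler \<alpha> \<beta> z) \<le> C * exp (\<epsilon> * cmod z)"
    by (intro exI[of _ "?D * exp (1 / \<epsilon>)"]) (auto intro: mult_pos_pos add_pos_nonneg)
qed

text \<open>The general theorem bounds below by the modulus at \<open>Re z\<close>, which dominates
  the real part. The value there is real, so \<open>Re\<close> only turns it into a real
  number.\<close>

theorem mainTheorem10:
  fixes \<alpha> \<beta> :: real
  assumes "\<alpha> \<ge> 2" and "\<beta> \<ge> 0"
    and "\<And>w. mittag_leffler \<alpha> \<beta> w = 0 \<Longrightarrow> w \<in> \<real>"
  shows "\<forall>z. cmod (mittag_leffler \<alpha> \<beta> z) \<ge> Re (mittag_leffler \<alpha> \<beta> (complex_of_real (Re z)))"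
  using minimal_type_real_zeros_norm_ge_Re[OF mittag_leffler_entire
      mittag_leffler_minimal_exponential_type, OF assms(1,2) assms(1,2) assms(3)]
    complex_Re_le_cmod order_trans
  by blast

end
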